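(* Let $G$ be a locally compact group with a compact generating set $K\ni 1$, and let $X$ be a complete Busemann non-positively curved uniformly convex metric space. Suppose that $G$ acts continuously by isometries on $X$ and that $d_K(x)\to\infty$ when $x\to\infty$, where $d_K(x)=\max_{k\in K}d(x,k\cdot x)$. Let $\Omega\subset G$ be a compact set such that $KU\subset\Omega$ for some non-empty open set $U\subset G$. For $x\in X$ let $$E_\Omega(x)=\int_{\Omega}d(x,g\cdot x)^2\,dg,$$ where $dg$ is a Haar measure on $G$, and let $r=\inf_{x\in X}E_\Omega(x)$. Then the set $$P=\{p\in X: E_\Omega(p)=r\}$$ is non-empty, closed, convex and bounded. Furthermore, if $X$ is a Banach space, then $P$ is a singleton.
   Context: $X$ is a (non-empty) geodesic metric space with metric $d$. It is strictly convex if every pair $y,z\in X$ has a midpoint $m_{y,z}$ (a point with $d(y,m_{y,z})=d(z,m_{y,z})=\tfrac12 d(y,z)$) and $d(x,m_{y,z})<\max\{d(x,y),d(x,z)\}$ for all $x$ and all $y\neq z$ (so midpoints and geodesic segments between points are unique). It is uniformly convex if it is strictly convex and for every $\epsilon>0$ there is $\delta(\epsilon)>0$ such that for all $r>0$ and $x,y,z\in X$ with $d(x,y)\le r$, $d(x,z)\le r$ and $d(y,z)\geq \epsilon r$ one has $d(x,m_{y,z})\le (1-\delta(\epsilon))r$. It is Busemann non-positively curved (BNPC) if $d(m_{x,y},m_{x,z})\le\tfrac12 d(y,z)$ for all $x,y,z\in X$. Examples are CAT(0) spaces and uniformly convex Banach spaces (with the norm metric). A subset of $X$ is convex if it contains the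 geodesic segment between any two of its points. "$x\to\infty$" means that $x$ eventually leaves every ball in $X$; thus "$d_K(x)\to\infty$ when $x\to\infty$" means that for every $R$ the set $\{x\in X: d_K(x)\le R\}$ is bounded. The action is continuous if the map $G\times X\to X$ is continuous. $KU=\{ku: k\in K,\ u\in U\}$. *)

theory Defs
  imports "HOL-Analysis.Analysis"
begin

text \<open>
  Groups are written additively: the library's class of topological groups,
  \<^class>\<open>topological_group_add\<close>, extends \<^class>\<open>group_add\<close>, which does not assume
  commutativity.
\<close>

section \<open>Geodesic metric spaces\<close>

definition is_geodesic :: "'a::metric_space \<Rightarrow> 'a \<Rightarrow> (real \<Rightarrow> 'a) \<Rightarrow> bool" where
  "is_geodesic y z c \<longleftrightarrow> c 0 = y \<and> c (dist y z) = z \<and>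
     (\<forall>s\<in>{0..dist y z}. \<forall>t\<in>{0..dist y z}. dist (c s) (c t) = \<bar>s - t\<bar>)"

definition geodesic_space :: "'a::metric_space itself \<Rightarrow> bool" where
  "geodesic_space _ \<longleftrightarrow> (\<forall>y z :: 'a. \<exists>c. is_geodesic y z c)"

definition geodesically_convex :: "'a::metric_space set \<Rightarrow> bool" where
  "geodesically_convex S \<longleftrightarrow>
     (\<forall>y\<in>S. \<forall>z\<in>S. \<forall>c. is_geodesic y z c \<longrightarrow> c ` {0..dist y z} \<subseteq> S)"

definition is_midpoint :: "'a::metric_space \<Rightarrow> 'a \<Rightarrow> 'a \<Rightarrow> bool" where
  "is_midpoint y z m \<longleftrightarrow> dist y m = dist y z / 2 \<and> dist z m = dist y z / 2"

text \<open>
  Midpoints are unique in a strictly convex space, so below ``for every midpoint of y and z''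
  and ``for the midpoint of y and z'' have the same meaning.
\<close>

definition strictly_convex_space :: "'a::metric_space itself \<Rightarrow> bool" where
  "strictly_convex_space _ \<longleftrightarrow>
     (\<forall>y z :: 'a. \<exists>m. is_midpoint y z m) \<and>
     (\<forall>x y z m :: 'a. y \<noteq> z \<longrightarrow> is_midpoint y z m \<longrightarrow> dist x m < max (dist x y) (dist x z))"

definition uniformly_convex_space :: "'a::metric_space itself \<Rightarrow> bool" where
  "uniformly_convex_space _ \<longleftrightarrow>
     strictly_convex_space TYPE('a) \<and>
     (\<forall>\<epsilon>>0. \<exists>\<delta>>0. \<forall>r>0. \<forall>x y z m :: 'a.
        dist x y \<le> r \<longrightarrow> dist x z \<le> r \<longrightarrow> dist y z \<ge> \<epsilon> * r \<longrightarrow> is_midpoint y z m \<longrightarrow>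
        dist x m \<le> (1 - \<delta>) * r)"

definition busemann_npc_space :: "'a::metric_space itself \<Rightarrow> bool" where
  "busemann_npc_space _ \<longleftrightarrow>
     (\<forall>x y z m n :: 'a. is_midpoint x y m \<longrightarrow> is_midpoint x z n \<longrightarrow> dist m n \<le> dist y z / 2)"

section \<open>Topological groups and Haar measure\<close>

inductive_set generated_subgroup :: "'g::group_add set \<Rightarrow> 'g set" for K where
  base: "k \<in> K \<Longrightarrow> k \<in> generated_subgroup K"
| zero: "0 \<in> generated_subgroup K"
| add: "g \<in> generated_subgroup K \<Longrightarrow> h \<in> generated_subgroup K \<Longrightarrow> g + h \<in> generated_subgroup K"
| minus: "g \<in> generated_subgroup K \<Longrightarrow> - g \<in> generated_subgroup K"

text \<open>A left Haar measure: a nonzero left-invariant Radon measure on the Borel sets.\<close>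

definition haar_measure :: "'g::{topological_group_add,t2_space} measure \<Rightarrow> bool" where
  "haar_measure M \<longleftrightarrow>
     sets M = sets borel \<and>
     emeasure M UNIV \<noteq> 0 \<and>
     (\<forall>g. \<forall>A\<in>sets borel. emeasure M ((\<lambda>x. g + x) ` A) = emeasure M A) \<and>
     (\<forall>C. compact C \<longrightarrow> emeasure M C < \<infinity>) \<and>
     (\<forall>A\<in>sets borel. emeasure M A = (INF V\<in>{V. open V \<and> A \<subseteq> V}. emeasure M V)) \<and>
     (\<forall>V. open V \<longrightarrow> emeasure M V = (SUP C\<in>{C. compact C \<and> C \<subseteq> V}. emeasure M C))"

section \<open>Isometric actions\<close>

definition continuous_isometric_action ::
    "('g::topological_group_add \<Rightarrow> 'a::metric_space \<Rightarrow> 'a) \<Rightarrow> bool" where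
  "continuous_isometric_action act \<longleftrightarrow>
     (\<forall>x. act 0 x = x) \<and>
     (\<forall>g h x. act (g + h) x = act g (act h x)) \<and>
     (\<forall>g x y. dist (act g x) (act g y) = dist x y) \<and>
     continuous_on UNIV (\<lambda>(g, x). act g x)"

text \<open>For compact nonempty \<open>K\<close> and a continuous action, the supremum is a maximum.\<close>

definition displacement :: "('g \<Rightarrow> 'a::metric_space \<Rightarrow> 'a) \<Rightarrow> 'g set \<Rightarrow> 'a \<Rightarrow> real" where
  "displacement act K x = (SUP k\<in>K. dist x (act k x))"

definition energy ::
    "'g measure \<Rightarrow> ('g \<Rightarrow> 'a::metric_space \<Rightarrow> 'a) \<Rightarrow> 'g set \<Rightarrow> 'a \<Rightarrow> real" where
  "energy M act \<Omega> x = (LINT g:\<Omega>|M. (dist x (act g x))\<^sup>2)"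

text \<open>
  A metric space type is a Banach space if its metric comes from some Banach space structure, i.e.
  if it is isometric to a Banach space; such an isometry is expressed by the following predicate.
\<close>

definition surjective_isometry :: "('a::metric_space \<Rightarrow> 'b::metric_space) \<Rightarrow> bool" where
  "surjective_isometry f \<longleftrightarrow> surj f \<and> (\<forall>x y. dist (f x) (f y) = dist x y)"

end

theory Submission
  imports Defs
begin

text \<open>An isometry carries midpoints to midpoints, so Busemann's inequality makes each
  displacement d(x, g x) midpoint-convex in x (\<open>busemann_npc_dist_midpoints\<close>). Squaring
  and integrating, E is midpoint-convex (\<open>energy_midpoint_le\<close>), and it is continuous by
  dominated convergence (\<open>tendsto_energy\<close>). Left invariance bounds d(x, k x)^2 by a
  constant multiple of E(x) for k in \<open>K\<close> (\<open>dist_act_sq_le_energy\<close>); as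
  \<open>d_K\<close> is proper, sublevel sets of E are bounded. They are thus closed, bounded and
  closed under midpoints. In a complete uniformly convex space a decreasing sequence of nonempty
  sets of this kind has a common point (\<open>uniformly_convex_decseq_Inter_nonempty\<close>),
  which yields a minimizer, and \<open>P\<close> is itself a sublevel set.

  In the Banach case, two minimizers p and q force equality in the midpoint inequality for almost
  every g in \<Omega>. Strict convexity of the norm then gives p - g p = q - g q, and since g
  preserves midpoints this displacement persists at all points p + n (q - p). E is therefore
  constant on an unbounded set unless p = q (\<open>banach_minimizer_unique\<close>).\<close>

section \<open>Closed sets that contain midpoints, and their nested intersections\<close>

lemma closed_midpoint_convex_interval:
  fixes S :: "real set"
  assumes "closed S" "a \<in> S" "b \<in> S"
    and mid: "\<And>s t. s \<in> S \<Longrightarrow> t \<in> S \<Longrightarrow> (s + t) / 2 \<in> S"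
  shows "{a..b} \<subseteq> S"
proof
  fix t assume t: "t \<in> {a..b}"
  have cl: "closed (S \<inter> {..t})" "closed (S \<inter> {t..})"
    using assms(1) by (auto intro: closed_Int)
  \<comment> \<open>The points of \<open>S\<close> nearest to \<open>t\<close> on either side. Their
    average lies in \<open>S\<close>, so it cannot fall strictly between them.\<close>
  define l u where "l = Sup (S \<inter> {..t})" and "u = Inf (S \<inter> {t..})"
  have bdd: "bdd_above (S \<inter> {..t})" "bdd_below (S \<inter> {t..})"
    by (auto intro: bdd_aboveI[of _ t] bdd_belowI[of _ t])
  have l: "l \<in> S \<inter> {..t}"
    unfolding l_def using cl(1) bdd(1) t assms(2) by (intro closed_contains_Sup) auto
  have u: "u \<in> S \<inter> {t..}"
    unfolding u_def using cl(2) bdd(2) t assms(3) by (intro closed_contains_Inf) auto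
  have m: "(l + u) / 2 \<in> S"
    using mid l u by blast
  have "l = t \<or> u = t"
  proof (cases "(l + u) / 2 \<le> t")
    case True
    then have "(l + u) / 2 \<le> l"
      unfolding l_def using m bdd(1) by (intro cSup_upper) (auto simp: l_def)
    with l u show ?thesis by auto
  next
    case False
    then have "u \<le> (l + u) / 2"
      unfolding u_def using m bdd(2) by (intro cInf_lower) (auto simp: u_def)
    with l u show ?thesis by auto
  qed
  with l u show "t \<in> S" by auto
qed

text \<open>A geodesic parametrized by arc length turns averages of parameters into midpoints, so
  the preimage of \<open>S\<close> in the parameter interval is closed, stable under averages, and
  contains both ends.\<close>

lemma closed_midpoint_convex_imp_geodesically_convex:
  fixes S :: "'a::metric_space set"
  assumes "closed S"
    and mid: "\<And>y z m. y \<in> S \<Longrightarrow> z \<in> S \<Longrightarrow> is_midpoint y z m \<Longrightarrow> m \<in> S"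
  shows "geodesically_convex S"
  unfolding geodesically_convex_def
proof (intro ballI allI impI)
  fix y z c assume y: "y \<in> S" and z: "z \<in> S" and c: "is_geodesic y z c"
  define L where "L = dist y z"
  have c': "c 0 = y" "c L = z"
    "\<And>s t. s \<in> {0..L} \<Longrightarrow> t \<in> {0..L} \<Longrightarrow> dist (c s) (c t) = \<bar>s - t\<bar>"
    using c by (auto simp: is_geodesic_def L_def)
  have "1-lipschitz_on {0..L} c"
    using c'(3) by (auto simp: lipschitz_on_def dist_real_def)
  then have "continuous_on {0..L} c"
    by (rule lipschitz_on_continuous_on)
  then have cl: "closed ({0..L} \<inter> c -` S)"
    using assms(1) by (intro continuous_closed_preimage) auto
  have "{0..L} \<subseteq> {0..L} \<inter> c -` S"
  proof (rule closed_midpoint_convex_interval[OF cl])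
    fix s t assume s: "s \<in> {0..L} \<inter> c -` S" and t: "t \<in> {0..L} \<inter> c -` S"
    then have st: "(s + t) / 2 \<in> {0..L}"
      by auto
    have "is_midpoint (c s) (c t) (c ((s + t) / 2))"
      unfolding is_midpoint_def using s t st c'(3) by (auto simp: abs_if field_simps)
    with mid s t st show "(s + t) / 2 \<in> {0..L} \<inter> c -` S"
      by auto
  qed (use y z c' in \<open>auto simp: L_def\<close>)
  then show "c ` {0..dist y z} \<subseteq> S"
    by (auto simp: L_def)
qed

text \<open>Almost-nearest points of the sets to a fixed point form a Cauchy sequence.\<close>

lemma uniformly_convex_decseq_Inter_nonempty:
  fixes C :: "nat \<Rightarrow> 'a::complete_space set"
  assumes uc: "uniformly_convex_space TYPE('a)"
    and dec: "decseq C" and cl: "\<And>n. closed (C n)" and ne: "\<And>n. C n \<noteq> {}"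
    and bdd: "bounded (C 0)"
    and mid: "\<And>n y z m. y \<in> C n \<Longrightarrow> z \<in> C n \<Longrightarrow> is_midpoint y z m \<Longrightarrow> m \<in> C n"
  shows "(\<Inter>n. C n) \<noteq> {}"
proof -
  fix x0 :: 'a
  define \<rho> where "\<rho> n = infdist x0 (C n)" for n
  have sub: "C n \<subseteq> C m" if "m \<le> n" for m n
    using dec that by (auto simp: decseq_def)
  obtain B where B: "\<And>y. y \<in> C 0 \<Longrightarrow> dist x0 y \<le> B"
    using bdd bounded_any_center by metis
  have "incseq \<rho>"
    unfolding incseq_def \<rho>_def using infdist_mono[OF sub ne] by blast
  moreover have "\<rho> n \<le> B" for n
  proof -
    obtain y where "y \<in> C n" using ne by blast
    then have "\<rho> n \<le> dist x0 y" "dist x0 y \<le> B"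
      using B sub[of 0 n] by (auto simp: \<rho>_def intro: infdist_le)
    then show ?thesis by simp
  qed
  \<comment> \<open>The distances from \<open>x0\<close> to the shrinking sets increase and are
    bounded, so they converge. If the limit is 0, then \<open>x0\<close> itself lies in every set; a
    positive limit is what makes uniform convexity effective below.\<close>
  ultimately obtain R where lim: "\<rho> \<longlonglongrightarrow> R" and le: "\<And>n. \<rho> n \<le> R"
    using incseq_convergent[of \<rho> B] by blast
  have nonneg: "0 \<le> \<rho> n" for n
    by (simp add: \<rho>_def infdist_nonneg)
  show ?thesis
  proof (cases "R = 0")
    case True
    then have "\<rho> n = 0" for n
      using le nonneg by (metis order_antisym)
    then have "x0 \<in> C n" for n
      using in_closed_iff_infdist_zero[OF cl ne] by (simp add: \<rho>_def)
    then show ?thesis by blast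
  next
    case False
    then have R: "R > 0"
      using le[of 0] nonneg[of 0] by simp
    \<comment> \<open>A nearest point is not known to exist, so a slack tending to 0 is
      allowed.\<close>
    have "\<exists>y\<in>C n. dist x0 y < \<rho> n + 1 / real (Suc n)" for n
    proof (rule ccontr)
      assume "\<not> ?thesis"
      then have "\<rho> n + 1 / real (Suc n) \<le> \<rho> n"
        unfolding \<rho>_def infdist_notempty[OF ne]
        by (intro cINF_greatest ne) (auto simp: not_less)
      then show False by simp
    qed
    then obtain y where y: "\<And>n. y n \<in> C n" "\<And>n. dist x0 (y n) < \<rho> n + 1 / real (Suc n)"
      by metis
    have "Cauchy y"
    proof (rule metric_CauchyI)
      fix e :: real assume e: "e > 0"
      \<comment> \<open>Chosen so that \<epsilon> times any radius up to \<open>R + 1\<close> is at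
        most \<open>e\<close>; the radius \<open>s\<close> below is such a radius.\<close>
      define \<epsilon> where "\<epsilon> = e / (R + 1)"
      have "\<epsilon> > 0"
        using e R by (simp add: \<epsilon>_def)
      then obtain \<delta> where "\<delta> > 0"
        and \<delta>: "\<And>r x y z m :: 'a. r > 0 \<Longrightarrow> dist x y \<le> r \<Longrightarrow> dist x z \<le> r \<Longrightarrow>
          dist y z \<ge> \<epsilon> * r \<Longrightarrow> is_midpoint y z m \<Longrightarrow> dist x m \<le> (1 - \<delta>) * r"
        using uc unfolding uniformly_convex_space_def by meson
      \<comment> \<open>The limit is \<delta> R > 0, so for some \<open>N\<close> shrinking the
        radius \<open>s\<close> by the factor 1 - \<delta> brings it below the distance from
        \<open>x0\<close> to \<open>C N\<close>.\<close>
      have "(\<lambda>n. \<rho> n - (1 - \<delta>) * (R + 1 / real (Suc n))) \<longlonglongrightarrow> R - (1 - \<delta>) * (R + 0)"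
        by (intro tendsto_intros lim LIMSEQ_Suc[OF lim_1_over_n])
      moreover have "R - (1 - \<delta>) * (R + 0) > 0"
        using R \<open>\<delta> > 0\<close> by (simp add: algebra_simps)
      ultimately have "eventually (\<lambda>n. \<rho> n - (1 - \<delta>) * (R + 1 / real (Suc n)) > 0) sequentially"
        by (rule order_tendstoD(1))
      then obtain N where N: "\<rho> N > (1 - \<delta>) * (R + 1 / real (Suc N))"
        by (auto simp: eventually_sequentially)
      define s where "s = R + 1 / real (Suc N)"
      have s: "s > 0" "\<epsilon> * s \<le> e"
      proof -
        show "s > 0" using R by (simp add: s_def add_pos_pos)
        have "s \<le> R + 1" by (simp add: s_def)
        then have "\<epsilon> * s \<le> \<epsilon> * (R + 1)"
          using \<open>\<epsilon> > 0\<close> by (intro mult_left_mono) auto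
        then show "\<epsilon> * s \<le> e" using R by (simp add: \<epsilon>_def)
      qed
      have near: "dist x0 (y n) \<le> s" if "n \<ge> N" for n
      proof -
        have "1 / real (Suc n) \<le> 1 / real (Suc N)"
          using that by (simp add: frac_le)
        with y(2)[of n] le[of n] show ?thesis by (simp add: s_def)
      qed
      have "dist (y m) (y n) < e" if "m \<ge> N" "n \<ge> N" for m n
      proof (rule ccontr)
        assume "\<not> dist (y m) (y n) < e"
        \<comment> \<open>Two far apart points of \<open>C N\<close> within \<open>s\<close> of
          \<open>x0\<close> would have a midpoint in \<open>C N\<close> closer to \<open>x0\<close>
          than \<open>C N\<close> is.\<close>
        then have far: "dist (y m) (y n) \<ge> \<epsilon> * s"
          using s by simp
        obtain w where w: "is_midpoint (y m) (y n) w"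
          using uc unfolding uniformly_convex_space_def strictly_convex_space_def by blast
        have "w \<in> C N"
          using mid w y(1) sub that by blast
        then have "\<rho> N \<le> dist x0 w"
          by (auto simp: \<rho>_def intro: infdist_le)
        also have "\<dots> \<le> (1 - \<delta>) * s"
          using \<delta>[OF s(1) near[OF that(1)] near[OF that(2)] far w] .
        finally show False using N by (simp add: s_def)
      qed
      then show "\<exists>M. \<forall>m\<ge>M. \<forall>n\<ge>M. dist (y m) (y n) < e"
        by blast
    qed
    then obtain p where p: "y \<longlonglongrightarrow> p"
      using Cauchy_convergent_iff convergent_def by blast
    have "p \<in> C n" for n
    proof (rule Lim_in_closed_set[OF cl _ _ p])
      show "eventually (\<lambda>k. y k \<in> C n) sequentially"
        using eventually_ge_at_top[of n] by eventually_elim (use y(1) sub in blast)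
    qed simp
    then show ?thesis by blast
  qed
qed

section \<open>Distance between midpoints in a Busemann space\<close>

text \<open>Split the quadrilateral by the diagonal from \<open>p\<close> to \<open>q'\<close> and
  apply the Busemann inequality to both triangles, comparing through the midpoint of the
  diagonal.\<close>

lemma busemann_npc_dist_midpoints:
  fixes p q p' q' m m' :: "'a::metric_space"
  assumes "strictly_convex_space TYPE('a)" "busemann_npc_space TYPE('a)"
    and "is_midpoint p q m" "is_midpoint p' q' m'"
  shows "dist m m' \<le> (dist p p' + dist q q') / 2"
proof -
  obtain n where n: "is_midpoint p q' n"
    using assms(1) unfolding strictly_convex_space_def by blast
  have "dist m n \<le> dist q q' / 2"
    using assms(2,3) n unfolding busemann_npc_space_def by blast
  moreover have "dist n m' \<le> dist p p' / 2"
  proof -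
    have "is_midpoint q' p n" "is_midpoint q' p' m'"
      using n assms(4) by (auto simp: is_midpoint_def dist_commute)
    then show ?thesis
      using assms(2) unfolding busemann_npc_space_def by blast
  qed
  ultimately show ?thesis
    using dist_triangle[of m m' n] by simp
qed

section \<open>Haar measure\<close>

lemma
  assumes "haar_measure M"
  shows haar_measure_sets: "sets M = sets borel"
    and haar_measure_space: "space M = UNIV"
    and haar_measure_translate: "A \<in> sets borel \<Longrightarrow> emeasure M ((\<lambda>x. g + x) ` A) = emeasure M A"
    and haar_measure_compact: "compact C \<Longrightarrow> emeasure M C < \<infinity>"
  using assms sets_eq_imp_space_eq[of M borel] by (auto simp: haar_measure_def)

text \<open>Finitely many translates of \<open>U\<close> cover any compact set. If \<open>U\<close>
  were null, so would be every compact set, and by inner regularity the whole group.\<close>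

lemma haar_measure_open_nonzero:
  fixes M :: "'g::{topological_group_add,t2_space} measure"
  assumes haar: "haar_measure M" and "open U" "U \<noteq> {}"
  shows "emeasure M U \<noteq> 0"
proof
  assume null: "emeasure M U = 0"
  obtain u where u: "u \<in> U" using assms(3) by blast
  have op: "open ((+) g ` U)" for g
  proof -
    have "(+) g ` U = (+) (- g) -` U"
      by (auto simp: image_iff add.assoc[symmetric]) (metis add_minus_cancel)
    moreover have "open ((+) (- g) -` U)"
      using assms(2) by (intro open_vimage continuous_intros)
    ultimately show ?thesis by simp
  qed
  have "emeasure M C = 0" if C: "compact C" for C
  proof -
    have "C \<subseteq> (\<Union>c\<in>C. (+) (c - u) ` U)"
    proof
      fix c assume "c \<in> C"
      moreover have "c \<in> (+) (c - u) ` U"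
        using u by (intro image_eqI[of _ _ u]) simp_all
      ultimately show "c \<in> (\<Union>c\<in>C. (+) (c - u) ` U)" by blast
    qed
    then obtain D where D: "D \<subseteq> C" "finite D" "C \<subseteq> (\<Union>c\<in>D. (+) (c - u) ` U)"
      using C op by (metis (no_types, lifting) compactE_image)
    have "(+) (c - u) ` U \<in> null_sets M" for c
      using haar_measure_translate[OF haar, of U "c - u"] null op assms(2)
      by (intro null_setsI) (auto simp: haar_measure_sets[OF haar])
    then have "(\<Union>c\<in>D. (+) (c - u) ` U) \<in> null_sets M"
      using D(2) by (intro null_sets_UN') (auto intro: countable_finite)
    moreover have "C \<in> sets M"
      using C by (simp add: haar_measure_sets[OF haar] borel_compact)
    ultimately have "C \<in> null_sets M"
      using D(3) null_sets_subset by blast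
    then show ?thesis by (simp add: null_setsD1)
  qed
  moreover have "emeasure M UNIV = (SUP C\<in>{C. compact C \<and> C \<subseteq> UNIV}. emeasure M C)"
    using haar unfolding haar_measure_def by blast
  ultimately have "emeasure M UNIV \<le> 0"
    by (simp only:) (intro SUP_least, simp)
  then show False
    using haar by (simp add: haar_measure_def)
qed

text \<open>Left invariance as an image measure, the form that permits the substitution u to k + u
  in integrals.\<close>

lemma haar_measure_distr_translate:
  fixes M :: "'g::{topological_group_add,t2_space} measure"
  assumes haar: "haar_measure M"
  shows "distr M M ((+) k) = M"
proof (rule measure_eqI)
  fix A assume "A \<in> sets (distr M M ((+) k))"
  then have A: "A \<in> sets M" "A \<in> sets borel"
    by (auto simp: haar_measure_sets[OF haar])
  have meas: "(+) k \<in> measurable M M"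
    unfolding measurable_cong_sets[OF haar_measure_sets[OF haar] haar_measure_sets[OF haar]]
    by (intro borel_measurable_continuous_onI continuous_intros)
  have "(+) k -` A \<inter> space M = (+) (- k) ` A"
    by (auto simp: haar_measure_space[OF haar] image_iff add.assoc[symmetric]) (metis minus_add_cancel)
  then show "emeasure (distr M M ((+) k)) A = emeasure M A"
    using haar_measure_translate[OF haar A(2)] by (simp add: emeasure_distr[OF meas A(1)])
qed simp

section \<open>The energy functional\<close>

lemma
  assumes "continuous_isometric_action act"
  shows act_add: "act (g + h) x = act g (act h x)"
    and act_dist: "dist (act g x) (act g y) = dist x y"
    and continuous_on_act: "continuous_on A (\<lambda>g. act g x)"
    and act_midpoint: "is_midpoint x y m \<Longrightarrow> is_midpoint (act g x) (act g y) (act g m)"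
proof -
  have "continuous_on UNIV (\<lambda>(g, x). act g x)"
    using assms by (simp add: continuous_isometric_action_def)
  then have "continuous_on A ((\<lambda>(g, x). act g x) \<circ> (\<lambda>g. (g, x)))"
    by (intro continuous_on_compose continuous_intros) (auto intro: continuous_on_subset)
  then show "continuous_on A (\<lambda>g. act g x)"
    by (simp add: o_def)
qed (use assms in \<open>auto simp: continuous_isometric_action_def is_midpoint_def\<close>)

locale energy_setting =
  fixes act :: "'g::{topological_group_add,t2_space} \<Rightarrow> 'x::metric_space \<Rightarrow> 'x"
    and M :: "'g measure" and \<Omega> :: "'g set"
  assumes action: "continuous_isometric_action act"
    and haar: "haar_measure M"
    and compact: "compact \<Omega>"
begin

lemma sets_\<Omega>: "\<Omega> \<in> sets M"
  by (simp add: haar_measure_sets[OF haar] borel_compact compact)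

lemma dist_act_measurable: "(\<lambda>g. dist x (act g x)) \<in> borel_measurable M"
  unfolding measurable_cong_sets[OF haar_measure_sets[OF haar] refl]
  by (intro borel_measurable_continuous_onI continuous_intros continuous_on_act[OF action])

lemma dist_act_bounded: "\<exists>B. \<forall>g\<in>\<Omega>. dist x (act g x) \<le> B"
proof -
  have "compact ((\<lambda>g. dist x (act g x)) ` \<Omega>)"
    by (intro compact_continuous_image compact continuous_intros continuous_on_act[OF action])
  then have "bdd_above ((\<lambda>g. dist x (act g x)) ` \<Omega>)"
    by (simp add: bounded_imp_bdd_above compact_imp_bounded)
  then show ?thesis by (auto simp: bdd_above_def)
qed

lemma integrable_const: "integrable M (\<lambda>g. indicator \<Omega> g *\<^sub>R (c::real))"
  using haar_measure_compact[OF haar compact] sets_\<Omega>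
  by (intro integrable_scaleR_left) (auto simp: integrable_indicator_iff)

lemma integrable_energy: "integrable M (\<lambda>g. indicator \<Omega> g *\<^sub>R (dist x (act g x))\<^sup>2)"
proof -
  obtain B where B: "\<And>g. g \<in> \<Omega> \<Longrightarrow> dist x (act g x) \<le> B"
    using dist_act_bounded by blast
  show ?thesis
  proof (rule Bochner_Integration.integrable_bound[OF integrable_const[of "B\<^sup>2"]])
    show "(\<lambda>g. indicator \<Omega> g *\<^sub>R (dist x (act g x))\<^sup>2) \<in> borel_measurable M"
      using dist_act_measurable sets_\<Omega> by measurable
    show "AE g in M. norm (indicator \<Omega> g *\<^sub>R (dist x (act g x))\<^sup>2) \<le> norm (indicator \<Omega> g *\<^sub>R B\<^sup>2)"
      using B by (intro always_eventually) (auto simp: indicator_def intro!: power_mono)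
  qed
qed

lemma energy_eq: "energy M act \<Omega> x = (LINT g|M. indicator \<Omega> g *\<^sub>R (dist x (act g x))\<^sup>2)"
  by (simp add: energy_def set_lebesgue_integral_def)

lemma energy_nonneg: "energy M act \<Omega> x \<ge> 0"
  unfolding energy_eq by (intro integral_nonneg_AE always_eventually) (auto simp: indicator_def)

text \<open>Dominated convergence: d(y, g y) exceeds d(x, g x) by at most 2 d(x, y), a convergent
  sequence is bounded, and \<Omega> has finite measure.\<close>

lemma tendsto_energy:
  assumes lim: "y \<longlonglongrightarrow> x"
  shows "(\<lambda>n. energy M act \<Omega> (y n)) \<longlonglongrightarrow> energy M act \<Omega> x"
proof -
  obtain B where B: "\<And>g. g \<in> \<Omega> \<Longrightarrow> dist x (act g x) \<le> B"
    using dist_act_bounded by blast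
  obtain D where D: "\<And>n. dist (y n) x \<le> D"
    using convergent_imp_bounded[OF lim] by (auto simp: bounded_any_center[where a=x] dist_commute)
  have bound: "dist (y n) (act g (y n)) \<le> B + 2 * D" if "g \<in> \<Omega>" for n g
    using B[OF that] D[of n] act_dist[OF action, of g x "y n"]
      dist_triangle[of "y n" "act g (y n)" x] dist_triangle[of x "act g (y n)" "act g x"]
    by (simp add: dist_commute)
  show ?thesis
    unfolding energy_eq
  proof (rule integral_dominated_convergence[where w = "\<lambda>g. indicator \<Omega> g *\<^sub>R (B + 2 * D)\<^sup>2"])
    show "(\<lambda>g. indicator \<Omega> g *\<^sub>R (dist x (act g x))\<^sup>2) \<in> borel_measurable M"
      "(\<lambda>g. indicator \<Omega> g *\<^sub>R (dist (y n) (act g (y n)))\<^sup>2) \<in> borel_measurable M" for n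
      using integrable_energy by (auto intro: borel_measurable_integrable)
    show "integrable M (\<lambda>g. indicator \<Omega> g *\<^sub>R (B + 2 * D)\<^sup>2)"
      by (rule integrable_const)
    show "AE g in M. (\<lambda>n. indicator \<Omega> g *\<^sub>R (dist (y n) (act g (y n)))\<^sup>2)
        \<longlonglongrightarrow> indicator \<Omega> g *\<^sub>R (dist x (act g x))\<^sup>2"
    proof (intro always_eventually allI)
      fix g
      have "(\<lambda>n. dist (act g (y n)) (act g x)) \<longlonglongrightarrow> 0"
        using lim by (simp add: act_dist[OF action] tendsto_dist_iff[symmetric])
      then have "(\<lambda>n. act g (y n)) \<longlonglongrightarrow> act g x"
        by (simp add: tendsto_dist_iff[symmetric])
      then show "(\<lambda>n. indicator \<Omega> g *\<^sub>R (dist (y n) (act g (y n)))\<^sup>2)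
          \<longlonglongrightarrow> indicator \<Omega> g *\<^sub>R (dist x (act g x))\<^sup>2"
        by (intro tendsto_intros lim)
    qed
    show "AE g in M. norm (indicator \<Omega> g *\<^sub>R (dist (y n) (act g (y n)))\<^sup>2)
        \<le> indicator \<Omega> g *\<^sub>R (B + 2 * D)\<^sup>2" for n
      using bound by (intro always_eventually) (auto simp: indicator_def intro!: power_mono)
  qed
qed

lemma closed_energy_le: "closed {x. energy M act \<Omega> x \<le> c}"
  unfolding closed_sequential_limits
  using LIMSEQ_le_const2[OF tendsto_energy] by auto

text \<open>\<open>act g m\<close> is a midpoint of \<open>act g p\<close> and
  \<open>act g q\<close>, so displacement is midpoint-convex; then the square function is
  convex.\<close>

lemma dist_act_midpoint_sq_le:
  assumes "strictly_convex_space TYPE('x)" "busemann_npc_space TYPE('x)" "is_midpoint p q m"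
  shows "(dist m (act g m))\<^sup>2 \<le> ((dist p (act g p))\<^sup>2 + (dist q (act g q))\<^sup>2) / 2"
proof -
  define a b where "a = dist p (act g p)" and "b = dist q (act g q)"
  have "dist m (act g m) \<le> (a + b) / 2"
    unfolding a_def b_def
    by (rule busemann_npc_dist_midpoints[OF assms act_midpoint[OF action assms(3)]])
  then have "(dist m (act g m))\<^sup>2 \<le> ((a + b) / 2)\<^sup>2"
    by (intro power_mono) auto
  also have "\<dots> \<le> (a\<^sup>2 + b\<^sup>2) / 2"
    using zero_le_power2[of "a - b"] by (simp add: power2_eq_square field_simps)
  finally show ?thesis by (simp add: a_def b_def)
qed

lemma
  assumes "strictly_convex_space TYPE('x)" "busemann_npc_space TYPE('x)" "is_midpoint p q m"
  shows energy_midpoint_le: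
      "energy M act \<Omega> m \<le> (energy M act \<Omega> p + energy M act \<Omega> q) / 2"
    and energy_midpoint_eqD:
      "energy M act \<Omega> m = (energy M act \<Omega> p + energy M act \<Omega> q) / 2 \<Longrightarrow>
        AE g in M. g \<in> \<Omega> \<longrightarrow>
          (dist m (act g m))\<^sup>2 = ((dist p (act g p))\<^sup>2 + (dist q (act g q))\<^sup>2) / 2"
proof -
  define e where "e x g = (indicator \<Omega> g *\<^sub>R (dist x (act g x))\<^sup>2 :: real)" for x g
  \<comment> \<open>The pointwise convexity defect. It is nonnegative, so its integral is too, and a
    vanishing integral makes it vanish almost everywhere.\<close>
  define f where "f g = (e p g + e q g) / 2 - e m g" for g
  have int: "integrable M (e x)" for x
    unfolding e_def by (rule integrable_energy)
  then have f_int: "integrable M f"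
    unfolding f_def by (intro Bochner_Integration.integrable_diff integrable_divide Bochner_Integration.integrable_add)
  have f_integral: "integral\<^sup>L M f = (energy M act \<Omega> p + energy M act \<Omega> q) / 2 - energy M act \<Omega> m"
    unfolding f_def energy_eq e_def[symmetric] using int by simp
  have nonneg: "f g \<ge> 0" for g
    using dist_act_midpoint_sq_le[OF assms, of g] by (auto simp: f_def e_def indicator_def)
  have "integral\<^sup>L M f \<ge> 0"
    using nonneg by (intro integral_nonneg_AE always_eventually) auto
  then show "energy M act \<Omega> m \<le> (energy M act \<Omega> p + energy M act \<Omega> q) / 2"
    using f_integral by simp
  assume "energy M act \<Omega> m = (energy M act \<Omega> p + energy M act \<Omega> q) / 2"
  then have "AE g in M. f g = 0"
    using integral_nonneg_eq_0_iff_AE[OF f_int] nonneg f_integral by auto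
  then show "AE g in M. g \<in> \<Omega> \<longrightarrow>
      (dist m (act g m))\<^sup>2 = ((dist p (act g p))\<^sup>2 + (dist q (act g q))\<^sup>2) / 2"
    by eventually_elim (auto simp: f_def e_def)
qed

text \<open>
  For \<open>k \<in> K\<close> and \<open>u \<in> U\<close> we have \<open>d(x, k x) \<le> d(x, k u x) + d(x, u x)\<close>; square, integrate over
  \<open>u \<in> U\<close> and use left invariance.
\<close>

lemma dist_act_sq_le_energy:
  assumes "open U" "0 \<in> K" "k \<in> K" and sub: "{k + u | k u. k \<in> K \<and> u \<in> U} \<subseteq> \<Omega>"
  shows "measure M U * (dist x (act k x))\<^sup>2 \<le> 4 * energy M act \<Omega> x"
proof -
  define D where "D = dist x (act k x)"
  define e where "e g = (indicator \<Omega> g *\<^sub>R (dist x (act g x))\<^sup>2 :: real)" for g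
  have e_int: "integrable M e"
    unfolding e_def by (rule integrable_energy)
  have meas: "(+) k \<in> measurable M M"
    unfolding measurable_cong_sets[OF haar_measure_sets[OF haar] haar_measure_sets[OF haar]]
    by (intro borel_measurable_continuous_onI continuous_intros)
  have ek_int: "integrable M (\<lambda>u. e (k + u))"
    using integrable_distr[OF meas, of e] e_int by (simp add: haar_measure_distr_translate[OF haar])
  have ek_eq: "(LINT u|M. e (k + u)) = energy M act \<Omega> x"
    using integral_distr[OF meas, of e] e_int
    unfolding haar_measure_distr_translate[OF haar] energy_eq e_def[symmetric] by simp
  \<comment> \<open>The first inclusion is where \<open>0 \<in> K\<close> enters: u = 0 + u.\<close>
  have in_\<Omega>: "u \<in> \<Omega>" "k + u \<in> \<Omega>" if "u \<in> U" for u
    using sub assms(2,3) that by (force, blast)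
  have U: "U \<in> sets M"
    using assms(1) by (simp add: haar_measure_sets[OF haar])
  have U_fin: "emeasure M U < \<infinity>"
    using in_\<Omega> emeasure_mono[OF _ sets_\<Omega>, of U] haar_measure_compact[OF haar compact]
    by (meson le_less_trans subsetI)
  have "measure M U * D\<^sup>2 = (LINT u|M. indicator U u *\<^sub>R D\<^sup>2)"
    using U U_fin by (simp add: haar_measure_space[OF haar])
  \<comment> \<open>From (a + b)^2 \<le> 2 a^2 + 2 b^2 on \<open>U\<close>; off \<open>U\<close> the
    left side is 0. Each of the two terms integrates to twice the energy, hence the factor
    4.\<close>
  also have "\<dots> \<le> (LINT u|M. 2 * e (k + u) + 2 * e u)"
  proof (rule integral_mono)
    show "integrable M (\<lambda>u. indicator U u *\<^sub>R D\<^sup>2)"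
      using U U_fin by (intro integrable_scaleR_left) (auto simp: integrable_indicator_iff)
    show "integrable M (\<lambda>u. 2 * e (k + u) + 2 * e u)"
      using e_int ek_int by simp
    fix u
    show "indicator U u *\<^sub>R D\<^sup>2 \<le> 2 * e (k + u) + 2 * e u"
    proof (cases "u \<in> U")
      case True
      define a b where "a = dist x (act (k + u) x)" and "b = dist x (act u x)"
      have "D \<le> a + b"
        using dist_triangle[of x "act k x" "act (k + u) x"]
        by (simp add: D_def a_def b_def act_add[OF action] act_dist[OF action] dist_commute)
      then have "D\<^sup>2 \<le> (a + b)\<^sup>2"
        by (intro power_mono) (auto simp: D_def)
      also have "\<dots> \<le> 2 * a\<^sup>2 + 2 * b\<^sup>2"
        using zero_le_power2[of "a - b"] by (simp add: power2_eq_square algebra_simps)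
      finally show ?thesis
        using True in_\<Omega>[OF True] by (simp add: e_def a_def b_def)
    qed (simp add: e_def indicator_def)
  qed
  also have "\<dots> = 4 * energy M act \<Omega> x"
    using e_int ek_int ek_eq unfolding energy_eq e_def[symmetric] by simp
  finally show ?thesis by (simp add: D_def)
qed

text \<open>Since \<open>U\<close> has positive finite measure, a bound on the energy bounds d(x, k
  x) uniformly over \<open>K\<close>, and properness of the displacement applies.\<close>

lemma bounded_energy_le:
  assumes "open U" "U \<noteq> {}" "0 \<in> K" and sub: "{k + u | k u. k \<in> K \<and> u \<in> U} \<subseteq> \<Omega>"
    and bdd: "\<And>R. bounded {x. displacement act K x \<le> R}"
  shows "bounded {x. energy M act \<Omega> x \<le> c}"
proof (rule bounded_subset[OF bdd])
  have "U \<subseteq> \<Omega>"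
    using sub assms(3) by force
  then have "emeasure M U < \<infinity>"
    using emeasure_mono[OF _ sets_\<Omega>] haar_measure_compact[OF haar compact] le_less_trans by blast
  then have pos: "measure M U > 0"
    using haar_measure_open_nonzero[OF haar assms(1,2)]
    by (simp add: measure_def enn2real_positive_iff zero_less_iff_neq_zero)
  show "{x. energy M act \<Omega> x \<le> c} \<subseteq> {x. displacement act K x \<le> sqrt (4 * c / measure M U)}"
  proof safe
    fix x assume "energy M act \<Omega> x \<le> c"
    then have "measure M U * (dist x (act k x))\<^sup>2 \<le> 4 * c" if "k \<in> K" for k
      using dist_act_sq_le_energy[OF assms(1,3) that sub, of x] by simp
    then have "(dist x (act k x))\<^sup>2 \<le> 4 * c / measure M U" if "k \<in> K" for k
      using pos that by (simp add: field_simps)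
    then show "displacement act K x \<le> sqrt (4 * c / measure M U)"
      unfolding displacement_def using assms(3) by (intro cSUP_least) (auto intro: real_le_rsqrt)
  qed
qed

end

section \<open>Banach spaces\<close>

text \<open>The linear average is a metric midpoint, and midpoints are unique: a midpoint of two
  distinct midpoints of \<open>x\<close> and \<open>y\<close> would be strictly closer than half
  their distance to both, against the triangle inequality.\<close>

lemma strictly_convex_banach_midpoint:
  fixes \<phi> :: "'x::metric_space \<Rightarrow> 'b::real_normed_vector"
  assumes sc: "strictly_convex_space TYPE('x)" and iso: "surjective_isometry \<phi>"
    and m: "is_midpoint x y m"
  shows "\<phi> m = (1/2) *\<^sub>R (\<phi> x + \<phi> y)"
proof -
  have d: "dist x y = norm (\<phi> x - \<phi> y)" for x y
    using iso by (metis surjective_isometry_def dist_norm)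
  obtain n where n: "\<phi> n = (1/2) *\<^sub>R (\<phi> x + \<phi> y)"
    using iso by (metis surjective_isometry_def surjD)
  have "\<phi> x - \<phi> n = (1/2) *\<^sub>R (\<phi> x - \<phi> y)" "\<phi> y - \<phi> n = (1/2) *\<^sub>R (\<phi> y - \<phi> x)"
    unfolding n by (simp_all add: algebra_simps scaleR_half_double flip: scaleR_add_left)
  then have n': "is_midpoint x y n"
    by (simp add: is_midpoint_def d norm_minus_commute)
  have "m = n"
  proof (rule ccontr)
    assume "m \<noteq> n"
    show False
    proof (cases "x = y")
      case True
      with m n' \<open>m \<noteq> n\<close> show False by (simp add: is_midpoint_def)
    next
      case False
      obtain w where w: "is_midpoint m n w"
        using sc unfolding strictly_convex_space_def by blast
      have "dist x w < max (dist x m) (dist x n)" "dist y w < max (dist y m) (dist y n)"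
        using sc w \<open>m \<noteq> n\<close> unfolding strictly_convex_space_def by blast+
      then have "dist x w + dist y w < dist x y"
        using m n' by (simp add: is_midpoint_def)
      then show False
        using dist_triangle2[of x y w] by simp
    qed
  qed
  with n show ?thesis by simp
qed

text \<open>Equality in the convexity of the squared norm forces \<open>a\<close> and
  \<open>b\<close> to have equal norms, shared by their average. Strict convexity, seen from the
  preimage of the origin, rules this out when \<open>a\<close> and \<open>b\<close> differ.\<close>

lemma strictly_convex_banach_eq:
  fixes \<phi> :: "'x::metric_space \<Rightarrow> 'b::real_normed_vector"
  assumes sc: "strictly_convex_space TYPE('x)" and iso: "surjective_isometry \<phi>"
    and eq: "(norm ((1/2) *\<^sub>R (a + b)))\<^sup>2 = ((norm a)\<^sup>2 + (norm b)\<^sup>2) / 2"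
  shows "a = (b :: 'b)"
proof (rule ccontr)
  assume "a \<noteq> b"
  have d: "dist x y = norm (\<phi> x - \<phi> y)" for x y
    using iso by (metis surjective_isometry_def dist_norm)
  obtain x y z m where xyz: "\<phi> x = 0" "\<phi> y = a" "\<phi> z = b" "\<phi> m = (1/2) *\<^sub>R (a + b)"
    using iso by (metis surjective_isometry_def surjD)
  have "a - (1/2) *\<^sub>R (a + b) = (1/2) *\<^sub>R (a - b)" "b - (1/2) *\<^sub>R (a + b) = (1/2) *\<^sub>R (b - a)"
    by (simp_all add: algebra_simps scaleR_half_double flip: scaleR_add_left)
  then have "is_midpoint y z m"
    by (simp add: is_midpoint_def d xyz norm_minus_commute)
  moreover have "y \<noteq> z"
    using \<open>a \<noteq> b\<close> xyz by auto
  ultimately have "dist x m < max (dist x y) (dist x z)"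
    using sc unfolding strictly_convex_space_def by blast
  then have less: "norm ((1/2) *\<^sub>R (a + b)) < max (norm a) (norm b)"
    by (simp only: d xyz diff_0 norm_minus_cancel)
  have "norm ((1/2) *\<^sub>R (a + b)) \<le> (norm a + norm b) / 2"
    using norm_triangle_ineq[of a b] by simp
  then have "(norm ((1/2) *\<^sub>R (a + b)))\<^sup>2 \<le> ((norm a + norm b) / 2)\<^sup>2"
    by (intro power_mono) auto
  with eq have "(norm a - norm b)\<^sup>2 \<le> 0"
    by (simp add: power2_eq_square field_simps)
  then have "norm a = norm b" by simp
  with eq have "norm ((1/2) *\<^sub>R (a + b)) = norm a"
    by (simp add: power2_eq_iff_nonneg)
  with less \<open>norm a = norm b\<close> show False by simp
qed

text \<open>\<open>f\<close> preserves midpoints and these are linear averages, so the images of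
  equally spaced points obey a second-order linear recurrence and form an arithmetic progression;
  \<open>start\<close> fixes its difference.\<close>

lemma strictly_convex_banach_isometry_line:
  fixes \<phi> :: "'x::metric_space \<Rightarrow> 'b::real_normed_vector"
  assumes sc: "strictly_convex_space TYPE('x)" and iso: "surjective_isometry \<phi>"
    and f: "\<And>x y. dist (f x) (f y) = dist x y"
    and l: "\<And>n. \<phi> (l n) = a + real n *\<^sub>R v"
    and start: "\<phi> (f (l 1)) = \<phi> (f (l 0)) + v"
  shows "\<phi> (f (l n)) = \<phi> (f (l 0)) + real n *\<^sub>R v"
proof -
  have d: "dist x y = norm (\<phi> x - \<phi> y)" for x y
    using iso by (metis surjective_isometry_def dist_norm)
  have step: "\<phi> (f (l (Suc (Suc n)))) = 2 *\<^sub>R \<phi> (f (l (Suc n))) - \<phi> (f (l n))" for n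
  proof -
    have "is_midpoint (l n) (l (Suc (Suc n))) (l (Suc n))"
      unfolding is_midpoint_def d l by (simp flip: scaleR_diff_left)
    then have "is_midpoint (f (l n)) (f (l (Suc (Suc n)))) (f (l (Suc n)))"
      by (simp add: is_midpoint_def f)
    from strictly_convex_banach_midpoint[OF sc iso this] show ?thesis
      by simp
  qed
  show ?thesis
  proof (induction n rule: induct_nat_012)
    case 1
    then show ?case using start by simp
  next
    case (ge2 n)
    then show ?case by (simp add: step scaleR_2 scaleR_add_left algebra_simps)
      (metis mult_2_right scaleR_add_left)
  qed simp
qed

text \<open>
  If \<open>p \<noteq> q\<close> are minimizers, almost every \<open>g \<in> \<Omega>\<close> satisfies \<open>g q - g p = q - p\<close>, so \<open>E\<close> is constant on
  the unbounded set of points \<open>p + n (q - p)\<close>.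
\<close>

lemma (in energy_setting) banach_minimizer_unique:
  fixes \<phi> :: "'x \<Rightarrow> 'b::real_normed_vector"
  assumes sc: "strictly_convex_space TYPE('x)" and bnpc: "busemann_npc_space TYPE('x)"
    and iso: "surjective_isometry \<phi>"
    and min: "\<And>x. r \<le> energy M act \<Omega> x"
    and bdd: "bounded {x. energy M act \<Omega> x \<le> r}"
    and p: "energy M act \<Omega> p = r" and q: "energy M act \<Omega> q = r"
  shows "p = q"
proof (rule ccontr)
  assume "p \<noteq> q"
  have d: "dist x y = norm (\<phi> x - \<phi> y)" for x y
    using iso by (metis surjective_isometry_def dist_norm)
  obtain m where m: "is_midpoint p q m"
    using sc unfolding strictly_convex_space_def by blast
  have "energy M act \<Omega> m = (energy M act \<Omega> p + energy M act \<Omega> q) / 2"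
    using energy_midpoint_le[OF sc bnpc m] min[of m] p q by simp
  note AE = energy_midpoint_eqD[OF sc bnpc m this]
  define v where "v = \<phi> q - \<phi> p"
  have "v \<noteq> 0"
    using \<open>p \<noteq> q\<close> d[of p q] by (auto simp: v_def)
  have "\<exists>x. \<phi> x = \<phi> p + real n *\<^sub>R v" for n
    using iso by (metis surjective_isometry_def surjD)
  then obtain l where l: "\<And>n. \<phi> (l n) = \<phi> p + real n *\<^sub>R v"
    by metis
  have l01: "l 0 = p" "l 1 = q"
    using d[of "l 0" p] d[of "l 1" q] l[of 0] l[of 1] by (auto simp: v_def)
  have same: "dist (l n) (act g (l n)) = dist p (act g p)"
    if "(dist m (act g m))\<^sup>2 = ((dist p (act g p))\<^sup>2 + (dist q (act g q))\<^sup>2) / 2" for g n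
  proof -
    \<comment> \<open>The displacement vector at the midpoint is the average of those at
      \<open>p\<close> and \<open>q\<close>, so the equality case for the squared norm makes the
      latter two agree.\<close>
    have "\<phi> m - \<phi> (act g m) = (1/2) *\<^sub>R ((\<phi> p - \<phi> (act g p)) + (\<phi> q - \<phi> (act g q)))"
      using strictly_convex_banach_midpoint[OF sc iso m]
        strictly_convex_banach_midpoint[OF sc iso act_midpoint[OF action m], of g]
      by (simp add: algebra_simps)
    then have "\<phi> p - \<phi> (act g p) = \<phi> q - \<phi> (act g q)"
      using that unfolding d by (intro strictly_convex_banach_eq[OF sc iso]) simp
    then have "\<phi> (act g (l 1)) = \<phi> (act g (l 0)) + v"
      unfolding l01 by (simp add: v_def algebra_simps)
    then have "\<phi> (act g (l n)) = \<phi> (act g (l 0)) + real n *\<^sub>R v"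
      by (intro strictly_convex_banach_isometry_line[OF sc iso _ l] act_dist[OF action])
    then show ?thesis
      unfolding d l by (simp add: l01)
  qed
  have "energy M act \<Omega> (l n) = r" for n
    unfolding p[symmetric] energy_eq
  proof (rule integral_cong_AE)
    show "AE g in M. indicator \<Omega> g *\<^sub>R (dist (l n) (act g (l n)))\<^sup>2 =
        indicator \<Omega> g *\<^sub>R (dist p (act g p))\<^sup>2"
      using AE by eventually_elim (auto simp: indicator_def same)
  qed (use integrable_energy in \<open>auto intro: borel_measurable_integrable\<close>)
  then have "range l \<subseteq> {x. energy M act \<Omega> x \<le> r}"
    by auto
  then have "bounded (range l)"
    using bdd bounded_subset by blast
  then obtain B where B: "\<And>n. dist p (l n) \<le> B"
    by (auto simp: bounded_any_center[where a=p])
  obtain n where "B < real n * norm v"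
    using reals_Archimedean3[of "norm v"] \<open>v \<noteq> 0\<close> by auto
  with B[of n] show False
    by (simp add: d l)
qed

section \<open>Existence, convexity and uniqueness of minimizers\<close>

theorem proposition2p1:
  fixes act :: "'g::{topological_group_add,t2_space} \<Rightarrow> 'x::complete_space \<Rightarrow> 'x"
    and K \<Omega> U :: "'g set"
    and M :: "'g measure"
    and r :: real
    and P :: "'x set"
  assumes "locally_compact_space (euclidean :: 'g topology)"
    and "compact K" and "0 \<in> K" and "generated_subgroup K = UNIV"
    and "geodesic_space TYPE('x)"
    and "uniformly_convex_space TYPE('x)"
    and "busemann_npc_space TYPE('x)"
    and "continuous_isometric_action act"
    and "\<And>R. bounded {x. displacement act K x \<le> R}"
    and "compact \<Omega>"
    and "open U" and "U \<noteq> {}" and "{k + u | k u. k \<in> K \<and> u \<in> U} \<subseteq> \<Omega>"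
    and "haar_measure M"
    and "r = (INF x. energy M act \<Omega> x)"
    and "P = {p. energy M act \<Omega> p = r}"
  shows "P \<noteq> {} \<and> closed P \<and> geodesically_convex P \<and> bounded P \<and>
    (\<forall>\<phi> :: 'x \<Rightarrow> 'b::banach. surjective_isometry \<phi> \<longrightarrow> is_singleton P)"
proof -
  note uc = assms(6) and bnpc = assms(7)
  have sc: "strictly_convex_space TYPE('x)"
    using uc by (simp add: uniformly_convex_space_def)
  interpret energy_setting act M \<Omega>
    using assms by unfold_locales
  have bdd: "bounded {x. energy M act \<Omega> x \<le> c}" for c
    by (rule bounded_energy_le[OF assms(11,12,3,13,9)])
  have min: "r \<le> energy M act \<Omega> x" for x
    unfolding assms(15) using energy_nonneg by (intro cINF_lower bdd_belowI2[of _ 0]) auto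
  have mid: "energy M act \<Omega> m \<le> c"
    if "energy M act \<Omega> y \<le> c" "energy M act \<Omega> z \<le> c" "is_midpoint y z m" for y z m c
    using energy_midpoint_le[OF sc bnpc that(3)] that(1,2) by simp
  \<comment> \<open>As a sublevel set, \<open>P\<close> inherits closedness, boundedness and
    stability under midpoints.\<close>
  have P: "P = {x. energy M act \<Omega> x \<le> r}"
    unfolding assms(16) using min by (auto intro: order_antisym)
  have "P \<noteq> {}"
  proof -
    \<comment> \<open>Sublevel sets at levels decreasing to the infimum: nonempty because each level
      exceeds \<open>r\<close>, and a common point has energy at most \<open>r\<close>.\<close>
    define C where "C n = {x. energy M act \<Omega> x \<le> r + 1 / real (Suc n)}" for n
    have "(\<Inter>n. C n) \<noteq> {}"
    proof (rule uniformly_convex_decseq_Inter_nonempty[OF uc])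
      show "decseq C"
      proof (rule decseq_SucI)
        fix n
        have "1 / real (Suc (Suc n)) \<le> 1 / real (Suc n)"
          by (simp add: frac_le)
        then show "C (Suc n) \<subseteq> C n"
          by (auto simp: C_def)
      qed
      show "C n \<noteq> {}" for n
      proof
        assume "C n = {}"
        then have "r + 1 / real (Suc n) \<le> (INF x. energy M act \<Omega> x)"
          by (intro cINF_greatest) (auto simp: C_def not_le less_imp_le)
        then show False by (simp add: assms(15))
      qed
    qed (auto simp: C_def intro: closed_energy_le bdd mid)
    then obtain x where x: "\<And>n. energy M act \<Omega> x \<le> r + 1 / real (Suc n)"
      by (auto simp: C_def)
    have "(\<lambda>n. r + 1 / real (Suc n)) \<longlonglongrightarrow> r + 0"
      by (intro tendsto_intros LIMSEQ_Suc[OF lim_1_over_n])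
    then have "energy M act \<Omega> x \<le> r"
      using x by (auto intro: LIMSEQ_le_const)
    then show ?thesis by (auto simp: P)
  qed
  moreover have "closed P"
    unfolding P by (rule closed_energy_le)
  moreover from this have "geodesically_convex P"
    by (rule closed_midpoint_convex_imp_geodesically_convex) (auto simp: P intro: mid)
  moreover have "bounded P"
    unfolding P by (rule bdd)
  moreover have "is_singleton P" if "surjective_isometry \<phi>" for \<phi> :: "'x \<Rightarrow> 'b::banach"
    using \<open>P \<noteq> {}\<close> banach_minimizer_unique[OF sc bnpc that min bdd]
    unfolding assms(16) by (auto simp: intro!: is_singletonI')
  ultimately show ?thesis by blast
qed

end
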